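(* For all integers $k \ge 0$ it holds that $S_2(k) = 2 \cdot a_2(k)$.
   Context: For an integer $k \ge 0$, $S_2(k)$ denotes the smallest integer $n \ge 0$ such that $2^k$ divides $n!$, except that by convention $S_2(0) = 0$ (equivalently, $S_2(k)$ is the smallest integer $n \ge 0$ with $k \le \sum_{i=1}^n \mathrm{ord}_2(i)$, where $\mathrm{ord}_2(i)$ is the largest $m \ge 0$ such that $2^m$ divides $i$). The sequence $a_2 : \mathbb{N}_0 \to \mathbb{N}_0$ is defined by $a_2(0) = 0$, $a_2(1) = 1$, and for $k \ge 2$ by the nested recursion $a_2(k) = a_2(k - a_2(k-1)) + a_2(k - 1 - a_2(k-2))$. Here $\mathbb{N}_0 = \{0,1,2,\dots\}$. *)

theory Defs
  imports Complex_Main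
begin

text \<open>Since \<^term>\<open>2 ^ 0 dvd fact 0\<close>, the case distinction is redundant; it records the
  convention for the value at zero.\<close>

definition S2 :: "nat \<Rightarrow> nat" where
  "S2 k = (if k = 0 then 0 else LEAST n. (2::nat) ^ k dvd fact n)"

text \<open>The nested recursion terminates only because \<open>a2 (k - 1) \<ge> 1\<close> for \<open>k \<ge> 2\<close>. The
  auxiliary constants \<open>last_pos\<close> (where \<open>last_pos m\<close> is the last index at which the sequence
  takes the value \<open>m\<close>) and \<open>level\<close> serve only to prove this. Subtraction on natural numbers
  never truncates in the recursion, by the lemma \<open>a2_le\<close> below.\<close>

function a2 :: "nat \<Rightarrow> nat" where
  "a2 0 = 0"
| "a2 (Suc 0) = 1"
| "k \<ge> 2 \<Longrightarrow> a2 k = a2 (k - a2 (k - 1)) + a2 (k - 1 - a2 (k - 2))"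
  by (atomize_elim, presburger) auto

fun last_pos :: "nat \<Rightarrow> nat" where
  "last_pos m = (if m = 0 then 0 else m + last_pos (m div 2))"

declare last_pos.simps [simp del]

lemma last_pos_0: "last_pos 0 = 0" by (simp add: last_pos.simps)

lemma last_pos_rec: "last_pos m = m + last_pos (m div 2)"
  by (subst last_pos.simps) (simp add: last_pos_0)

lemma last_pos_less_Suc: "last_pos m < last_pos (Suc m)"
proof (induction m rule: less_induct)
  case (less m)
  show ?case
  proof (cases "even m")
    case True
    then show ?thesis by (simp add: last_pos_rec [of m] last_pos_rec [of "Suc m"])
  next
    case False
    then have "Suc m div 2 = Suc (m div 2)" "m div 2 < m" by (auto elim!: oddE)
    then show ?thesis using less [of "m div 2"]
      by (simp add: last_pos_rec [of m] last_pos_rec [of "Suc m"])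
  qed
qed

lemma last_pos_mono: "m \<le> n \<Longrightarrow> last_pos m \<le> last_pos n"
  by (rule lift_Suc_mono_le [of last_pos]) (simp_all add: less_imp_le last_pos_less_Suc)

lemma le_last_pos: "m \<le> last_pos m"
  by (simp add: last_pos_rec [of m])

definition level :: "nat \<Rightarrow> nat" where
  "level k = (LEAST m. k \<le> last_pos m)"

lemma level_0: "level 0 = 0"
  by (simp add: level_def)

lemma level_eqI: "last_pos m < k \<Longrightarrow> k \<le> last_pos (Suc m) \<Longrightarrow> level k = Suc m"
  unfolding level_def
proof (rule Least_equality)
  fix n
  assume "last_pos m < k" "k \<le> last_pos n"
  then show "Suc m \<le> n" using last_pos_mono [of n m] by (cases "n \<le> m") auto
qed

lemma level_cases:
  assumes "k \<ge> 1"
  obtains m where "level k = Suc m" "last_pos m < k" "k \<le> last_pos (Suc m)"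
proof -
  have *: "k \<le> last_pos (level k)" unfolding level_def by (rule LeastI [of _ k]) (rule le_last_pos)
  with assms obtain m where m: "level k = Suc m" by (cases "level k") (auto simp: last_pos_0)
  moreover have "last_pos m < k"
    using not_less_Least [of m "\<lambda>m. k \<le> last_pos m"] m unfolding level_def by auto
  ultimately show ?thesis using * that by auto
qed

lemma level_le: "level k \<le> k"
  unfolding level_def by (rule Least_le) (rule le_last_pos)

lemma level_pos: "k \<ge> 1 \<Longrightarrow> level k \<ge> 1"
  by (erule level_cases) simp

lemma level_step:
  assumes "k \<ge> 1" "level k = Suc m"
  shows "level (k - level (k - 1)) = Suc (m div 2)"
    and "level (k - 1) = m \<or> level (k - 1) = Suc m \<and> odd m"
proof -
  from assms have k: "last_pos m < k" "k \<le> last_pos (Suc m)" by (metis level_cases nat.inject)+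
  note Tm = last_pos_rec [of m] last_pos_rec [of "Suc m"]
  show "level (k - level (k - 1)) = Suc (m div 2)"
    and "level (k - 1) = m \<or> level (k - 1) = Suc m \<and> odd m"
  proof (atomize (full), cases "k = Suc (last_pos m)")
    case True
    have "level (k - 1) = m"
    proof (cases m)
      case (Suc n)
      then show ?thesis using True last_pos_less_Suc [of n] by (auto intro: level_eqI)
    qed (simp add: True last_pos_0 level_0)
    moreover have "level (k - m) = Suc (m div 2)"
      using True Tm(1) last_pos_less_Suc [of "m div 2"] by (intro level_eqI) auto
    ultimately show "level (k - level (k - 1)) = Suc (m div 2) \<and>
        (level (k - 1) = m \<or> level (k - 1) = Suc m \<and> odd m)" by simp
  next
    case False
    with k have k': "Suc (last_pos m) < k" by simp
    have "odd m"
    proof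
      assume "even m"
      with Tm k k' show False by simp
    qed
    then have h: "Suc m div 2 = Suc (m div 2)" by (auto elim!: oddE)
    have "level (k - 1) = Suc m" using k k' by (intro level_eqI) auto
    moreover have "level (k - Suc m) = Suc (m div 2)"
      using k k' Tm h by (intro level_eqI) auto
    ultimately show "level (k - level (k - 1)) = Suc (m div 2) \<and>
        (level (k - 1) = m \<or> level (k - 1) = Suc m \<and> odd m)" using \<open>odd m\<close> by simp
  qed
qed

lemma level_rec:
  assumes "k \<ge> 2"
  shows "level k = level (k - level (k - 1)) + level (k - 1 - level (k - 2))"
proof -
  from assms level_pos [of k] obtain m where m: "level k = Suc m" by (cases "level k") auto
  from assms level_pos [of "k - 1"] obtain n where n: "level (k - 1) = Suc n"
    by (cases "level (k - 1)") force+
  have 1: "level (k - level (k - 1)) = Suc (m div 2)"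
    and 2: "Suc n = m \<or> n = m \<and> odd m"
    using level_step [of k m] assms m n by auto
  have "level (k - 1 - level (k - 2)) = Suc (n div 2)"
    using level_step(1) [of "k - 1" n] assms n by (simp add: numeral_2_eq_2)
  with 1 2 m show ?thesis by presburger
qed

lemma a2_eq_level: "a2_dom k \<Longrightarrow> a2 k = level k"
proof (induction k rule: a2.pinduct)
  case 2
  then show ?case using level_pos [of 1] level_le [of 1] by (simp add: a2.psimps)
next
  case (3 k)
  then show ?case by (simp add: a2.psimps level_rec [of k])
qed (simp add: a2.psimps level_0)

lemma a2_dom: "a2_dom k"
proof (rule spec [OF a2.termination])
  show "wf (measure (id :: nat \<Rightarrow> nat))" by simp
next
  fix k :: nat
  assume "k \<ge> 2" "a2_dom (k - 1)"
  then show "(k - a2 (k - 1), k) \<in> measure id"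
    using level_pos [of "k - 1"] a2_eq_level [of "k - 1"] by simp linarith
qed auto

termination a2
  using a2_dom by blast

declare a2.simps(3) [simp del]

lemma a2_le: "a2 k \<le> k"
  by (simp add: a2_eq_level a2_dom level_le)

end

theory Submission imports Defs begin

text \<open>The defining recursion \<open>last_pos m = m + last_pos (m div 2)\<close> is that of the 2-adic
  valuation of \<open>(2 * m)!\<close>, because \<open>(2 * m)!\<close> is \<open>2 ^ m * m!\<close> times an odd number. Passing
  from \<open>(2 * m)!\<close> to \<open>(2 * m + 1)!\<close> does not change the valuation, so \<open>S2 k\<close> is twice the least
  \<open>m\<close> with \<open>k \<le> last_pos m\<close>, and this \<open>m\<close> is \<open>a2 k\<close>.\<close>

text \<open>The even factors of \<open>fact (2 * m)\<close> multiply to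
  \<open>2 ^ m * fact m\<close>; the odd factors make up \<open>q\<close>.\<close>

lemma fact_double_decomp: "\<exists>q. odd q \<and> (fact (2 * m) :: nat) = 2 ^ m * fact m * q"
proof (induction m)
  case 0
  show ?case by (intro exI [of _ 1]) simp
next
  case (Suc m)
  then obtain q where "odd q" and q: "(fact (2 * m) :: nat) = 2 ^ m * fact m * q" by blast
  have "(fact (2 * Suc m) :: nat) = 2 ^ Suc m * fact (Suc m) * (Suc (2 * m) * q)"
  proof -
    have "(fact (2 * Suc m) :: nat) = (2 * Suc m) * (Suc (2 * m) * fact (2 * m))"
      by simp
    then show ?thesis unfolding q by (simp only: power_Suc fact_Suc of_nat_id mult_ac)
  qed
  moreover have "odd (Suc (2 * m) * q)" using \<open>odd q\<close> by simp
  ultimately show ?case by blast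
qed

lemma fact_two_adic_decomp: "\<exists>q. odd q \<and> (fact n :: nat) = 2 ^ last_pos (n div 2) * q"
proof (induction n rule: less_induct)
  case (less n)
  show ?case
  proof (cases "n = 0")
    case False
    define m where "m = n div 2"
    then have "m < n" using False by simp
    then obtain q where "odd q" and q: "(fact m :: nat) = 2 ^ last_pos (m div 2) * q"
      using less by blast
    obtain r where "odd r" and r: "(fact (2 * m) :: nat) = 2 ^ m * fact m * r"
      using fact_double_decomp by blast
    have fact_even: "(fact (2 * m) :: nat) = 2 ^ last_pos m * (q * r)"
      by (simp add: r q last_pos_rec [of m] power_add)
    \<comment> \<open>For odd \<open>n\<close>, the one factor of \<open>fact n\<close> missing from
      \<open>fact (2 * m)\<close> is \<open>n\<close> itself, which is odd.\<close>
    define s where "s = (if even n then 1 else n)"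
    have "odd s" by (simp add: s_def)
    have "(fact n :: nat) = s * fact (2 * m)"
    proof (cases "even n")
      case False
      then have "n = Suc (2 * m)" unfolding m_def by simp
      then show ?thesis by (simp add: s_def)
    qed (simp add: s_def m_def)
    then have "(fact n :: nat) = 2 ^ last_pos m * (s * q * r)" "odd (s * q * r)"
      using fact_even \<open>odd s\<close> \<open>odd q\<close> \<open>odd r\<close> by simp_all
    then show ?thesis unfolding m_def by blast
  qed (simp add: last_pos_0)
qed

lemma two_power_dvd_fact_iff: "(2::nat) ^ k dvd fact n \<longleftrightarrow> k \<le> last_pos (n div 2)"
proof -
  obtain q where "odd q" and q: "(fact n :: nat) = 2 ^ last_pos (n div 2) * q"
    using fact_two_adic_decomp by blast
  then have "coprime ((2::nat) ^ k) q" by simp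
  then show ?thesis by (simp add: q coprime_dvd_mult_left_iff dvd_power_iff_le)
qed

text \<open>A Galois connection: \<open>level\<close> is the lower adjoint of the monotone
  \<open>last_pos\<close>.\<close>

lemma le_last_pos_iff: "k \<le> last_pos m \<longleftrightarrow> level k \<le> m"
proof
  show "level k \<le> m" if "k \<le> last_pos m"
    unfolding level_def using that by (rule Least_le)
  have "k \<le> last_pos (level k)"
    unfolding level_def by (rule LeastI [of _ k]) (rule le_last_pos)
  then show "k \<le> last_pos m" if "level k \<le> m"
    using last_pos_mono [OF that] by linarith
qed

theorem theorem3p16:
  fixes k :: nat
  shows "S2 k = 2 * a2 k"
proof -
  have "(LEAST n. (2::nat) ^ k dvd fact n) = 2 * level k"
    \<comment> \<open>The condition on \<open>n\<close> becomes
      \<open>level k \<le> n div 2\<close>, so the least solution is even.\<close>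
    unfolding two_power_dvd_fact_iff le_last_pos_iff by (rule Least_equality) auto
  then show ?thesis by (simp add: S2_def a2_eq_level a2_dom level_0)
qed

end
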